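(* Let $Z\subset\{0,1\}^n$ be a code of size $N$ with distance distribution $(A_w)$ and dual distance distribution $(A_k^\perp)$, let $g_0,\dots,g_n\ge0$, $\gamma(t)=\sum_{i=t}^ng_i$, and $\lambda_G(w)$ the common value of $\frac12\sum_{z}|\gamma(d(x,z))-\gamma(d(y,z))|$ for $d(x,y)=w$. Then $$D_G^{L_2}(Z)=\langle\lambda_G\rangle_{\mathcal X}-\frac1N\sum_{w=1}^nA_w\lambda_G(w)=\frac1{2^n}\sum_{k=1}^nA_k^\perp\sum_{t=0}^{n-1}g_t\big(K_t^{(n-1)}(k-1)\big)^2,$$ where $\langle\lambda_G\rangle_{\mathcal X}=2^{-2n}\sum_{x,y}\lambda_G(d(x,y))$.
   Context: $\mathcal X=\{0,1\}^n$, $d$ Hamming distance, $B(x,t)=\{y:d(x,y)\le t\}$. $D_G^{L_2}(Z)=\sum_{t=0}^ng_t\sum_{x\in\mathcal X}\Big(\frac1N\sum_{j=1}^N\mathbb 1_{B(x,t)}(z_j)-\frac{|B(x,t)|}{2^n}\Big)^2$. $A_w=\frac1N|\{(z,z')\in Z^2:d(z,z')=w\}|$; Krawtchouk polynomials $K_k^{(m)}(x)=\sum_{i=0}^k(-1)^i\binom xi\binom{m-x}{k-i}$; $A_k^\perp=\frac1N\sum_{i=0}^nK_k^{(n)}(i)A_i$. *)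

theory Defs
  imports Complex_Main "HOL-Library.Indicator_Function"
begin

definition cube :: "nat \<Rightarrow> bool list set" where
  "cube n = {x. length x = n}"

definition hamming :: "bool list \<Rightarrow> bool list \<Rightarrow> nat" where
  "hamming x y = card {i. i < length x \<and> x ! i \<noteq> y ! i}"

definition hball :: "nat \<Rightarrow> bool list \<Rightarrow> nat \<Rightarrow> bool list set" where
  "hball n x t = {y \<in> cube n. hamming x y \<le> t}"

definition discrepancy :: "nat \<Rightarrow> (nat \<Rightarrow> real) \<Rightarrow> bool list set \<Rightarrow> real" where
  "discrepancy n g Z = (\<Sum>t = 0..n. g t * (\<Sum>x \<in> cube n.
     (1 / real (card Z) * (\<Sum>z \<in> Z. indicator (hball n x t) z)
       - real (card (hball n x t)) / 2 ^ n)\<^sup>2))"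

definition dist_distr :: "bool list set \<Rightarrow> nat \<Rightarrow> real" where
  "dist_distr Z w = 1 / real (card Z) * real (card {(z, z'). z \<in> Z \<and> z' \<in> Z \<and> hamming z z' = w})"

text \<open>A genuine polynomial in \<open>x\<close>, hence the generalised binomial coefficients.\<close>

definition krawtchouk :: "nat \<Rightarrow> nat \<Rightarrow> real \<Rightarrow> real" where
  "krawtchouk m k x = (\<Sum>i = 0..k. (- 1) ^ i * (x gchoose i) * ((real m - x) gchoose (k - i)))"

definition dual_distr :: "nat \<Rightarrow> bool list set \<Rightarrow> nat \<Rightarrow> real" where
  "dual_distr n Z k = 1 / real (card Z) * (\<Sum>i = 0..n. krawtchouk n k (real i) * dist_distr Z i)"

definition tail_weight :: "nat \<Rightarrow> (nat \<Rightarrow> real) \<Rightarrow> nat \<Rightarrow> real" where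
  "tail_weight n g t = (\<Sum>i = t..n. g i)"

definition pair_potential :: "nat \<Rightarrow> (nat \<Rightarrow> real) \<Rightarrow> bool list \<Rightarrow> bool list \<Rightarrow> real" where
  "pair_potential n g x y =
     1 / 2 * (\<Sum>z \<in> cube n. \<bar>tail_weight n g (hamming x z) - tail_weight n g (hamming y z)\<bar>)"

text \<open>
  The common value of \<^const>\<open>pair_potential\<close> over all pairs at distance \<open>w\<close>. It exists and is
  unique for \<open>w \<le> n\<close> (lemma \<open>potential_hamming\<close> below); for \<open>w > n\<close> it is unspecified.
\<close>

definition potential :: "nat \<Rightarrow> (nat \<Rightarrow> real) \<Rightarrow> nat \<Rightarrow> real" where
  "potential n g w =
     (THE c. \<forall>x \<in> cube n. \<forall>y \<in> cube n. hamming x y = w \<longrightarrow> pair_potential n g x y = c)"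

definition potential_mean :: "nat \<Rightarrow> (nat \<Rightarrow> real) \<Rightarrow> real" where
  "potential_mean n g =
     1 / 2 ^ (2 * n) * (\<Sum>x \<in> cube n. \<Sum>y \<in> cube n. potential n g (hamming x y))"

lemma hamming_Nil [simp]: "hamming [] y = 0"
  by (simp add: hamming_def)

lemma hamming_Cons [simp]:
  "hamming (a # x) (b # y) = (if a = b then 0 else 1) + hamming x y"
proof -
  have "{i. i < length (a # x) \<and> (a # x) ! i \<noteq> (b # y) ! i}
      = (if a = b then {} else {0}) \<union> Suc ` {i. i < length x \<and> x ! i \<noteq> y ! i}" (is "?L = ?R")
  proof (rule set_eqI)
    fix i show "i \<in> ?L \<longleftrightarrow> i \<in> ?R" by (cases i) auto
  qed
  then show ?thesis
    by (auto simp: hamming_def card_image card_insert_if)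
qed

lemma hamming_le_length: "hamming x y \<le> length x"
  unfolding hamming_def by (rule order_trans[OF card_mono[of "{..<length x}"]]) auto

lemma finite_cube [simp]: "finite (cube n)"
  using finite_lists_length_eq[of "UNIV :: bool set" n] by (simp add: cube_def)

lemma cube_0: "cube 0 = {[]}"
  by (simp add: cube_def)

lemma sum_cube_Suc:
  "(\<Sum>z \<in> cube (Suc n). f z) = (\<Sum>z \<in> cube n. f (True # z) + f (False # z) :: real)"
proof -
  have "cube (Suc n) = (#) True ` cube n \<union> (#) False ` cube n"
    by (auto simp: cube_def length_Suc_conv image_iff)
  then show ?thesis
    by (subst \<open>cube (Suc n) = _\<close>, subst sum.union_disjoint) (auto simp: sum.reindex sum.distrib)
qed

lemma sum_cube_hamming_cong:
  fixes F :: "nat \<Rightarrow> nat \<Rightarrow> real"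
  assumes "x \<in> cube n" "y \<in> cube n" "x' \<in> cube n" "y' \<in> cube n"
    and "hamming x y = hamming x' y'"
  shows "(\<Sum>z \<in> cube n. F (hamming x z) (hamming y z)) =
    (\<Sum>z \<in> cube n. F (hamming x' z) (hamming y' z))"
proof -
  define P where "P = (\<lambda>f (i::nat) (j::nat). f (Suc i) (Suc j) + f i j :: real)"
  define Q where "Q = (\<lambda>f (i::nat) (j::nat). f (Suc i) j + f i (Suc j) :: real)"
  have PQ: "P (Q f) = Q (P f)" for f
    by (simp add: P_def Q_def fun_eq_iff)
  have QP: "(Q ^^ k) (P f) = P ((Q ^^ k) f)" for k f
    by (induction k) (simp_all add: PQ)
  have main: "(\<Sum>z \<in> cube n. f (hamming x z) (hamming y z)) =
      (P ^^ (n - hamming x y)) ((Q ^^ hamming x y) f) 0 0"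
    if "length x = n" "length y = n" for f n x y
    using that
  proof (induction n arbitrary: f x y)
    case 0
    then show ?case by (simp add: cube_0)
  next
    case (Suc n)
    from Suc.prems obtain a x1 b y1 where xy: "x = a # x1" "y = b # y1" "length x1 = n" "length y1 = n"
      by (auto simp: length_Suc_conv)
    show ?case
    proof (cases "a = b")
      case True
      have "(\<Sum>z \<in> cube (Suc n). f (hamming x z) (hamming y z)) =
          (\<Sum>z \<in> cube n. P f (hamming x1 z) (hamming y1 z))"
        unfolding sum_cube_Suc by (rule sum.cong) (auto simp: xy True P_def)
      also have "\<dots> = (P ^^ (n - hamming x1 y1)) (P ((Q ^^ hamming x1 y1) f)) 0 0"
        by (simp add: Suc.IH xy QP)
      also have "\<dots> = (P ^^ Suc (n - hamming x1 y1)) ((Q ^^ hamming x1 y1) f) 0 0"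
        by (simp only: funpow_Suc_right o_apply)
      finally show ?thesis
        using hamming_le_length[of x1 y1] by (simp add: xy True Suc_diff_le)
    next
      case False
      have "(\<Sum>z \<in> cube (Suc n). f (hamming x z) (hamming y z)) =
          (\<Sum>z \<in> cube n. Q f (hamming x1 z) (hamming y1 z))"
        unfolding sum_cube_Suc using False by (intro sum.cong) (auto simp: xy Q_def)
      also have "\<dots> = (P ^^ (n - hamming x1 y1)) ((Q ^^ Suc (hamming x1 y1)) f) 0 0"
        by (simp add: Suc.IH xy funpow_Suc_right del: funpow.simps)
      finally show ?thesis
        using False by (simp add: xy)
    qed
  qed
  have "length x = n" "length y = n" "length x' = n" "length y' = n"
    using assms by (simp_all add: cube_def)
  then show ?thesis
    using main[of x n y F] main[of x' n y' F] assms(5) by metis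
qed

lemma potential_hamming:
  assumes "x \<in> cube n" "y \<in> cube n"
  shows "potential n g (hamming x y) = pair_potential n g x y"
  unfolding potential_def
proof (rule the_equality)
  show "\<forall>x' \<in> cube n. \<forall>y' \<in> cube n. hamming x' y' = hamming x y \<longrightarrow>
      pair_potential n g x' y' = pair_potential n g x y"
  proof (intro ballI impI)
    fix x' y' assume "x' \<in> cube n" "y' \<in> cube n" "hamming x' y' = hamming x y"
    then show "pair_potential n g x' y' = pair_potential n g x y"
      unfolding pair_potential_def
      by (rule arg_cong[OF sum_cube_hamming_cong[OF _ _ assms,
            where F = "\<lambda>i j. \<bar>tail_weight n g i - tail_weight n g j\<bar>"]])
  qed
qed (use assms in auto)

end

theory Submission
  imports Defs
begin

text \<open>
  Let \<open>\<nu>\<close> be the signed measure \<open>1\<^sub>Z / N - 2\<^sup>-\<^sup>n\<close>, of total mass zero, so that the discrepancy is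
  \<open>\<Sum>\<^sub>t g\<^sub>t \<parallel>\<nu> * 1\<^sub>B\<^sub>(\<^sub>0\<^sub>,\<^sub>t\<^sub>)\<parallel>\<^sup>2\<close>. Since \<open>g \<ge> 0\<close> makes \<open>\<gamma>\<close> monotone, \<open>\<lambda>(d(y,z))\<close> is half the \<open>g\<close>-weighted
  sum of the squared \<open>L\<^sub>2\<close>-distances between the ball indicators centred at \<open>y\<close> and \<open>z\<close>, and mass zero
  turns the discrepancy into \<open>- \<Sum> \<nu>(y) \<nu>(z) \<lambda>(d(y,z))\<close>; homogeneity of the cube removes the mixed
  terms. For the dual formula apply Parseval: the transform of a ball is
  \<open>\<Sum>\<^sub>j\<^sub>\<le>\<^sub>t K\<^sub>j(k)\<close>, which telescopes, and the power spectrum of \<open>\<nu>\<close> on the weight-\<open>k\<close> sphere is the dual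
  distance distribution.
\<close>

section \<open>Krawtchouk polynomials\<close>

lemma krawtchouk_0 [simp]: "krawtchouk m 0 x = 1"
  by (simp add: krawtchouk_def)

lemma gbinomial_Suc_shift:
  "(x + 1 :: real) gchoose Suc k = (x gchoose Suc k) + (x gchoose k)"
  by (simp add: gbinomial_Suc_Suc)

text \<open>In the generating function \<open>(1 - s) ^ x * (1 + s) ^ (m - x)\<close>, raising
  \<open>m\<close> and \<open>x\<close> together adds a factor \<open>1 - s\<close>. Coefficientwise
  this is Pascal's rule for \<open>x gchoose i\<close>.\<close>

lemma krawtchouk_Suc_Suc_shift:
  "krawtchouk (Suc m) (Suc k) (x + 1) = krawtchouk m (Suc k) x - krawtchouk m k x"
proof -
  let ?b = "\<lambda>j. (real m - x) gchoose j"
  have "krawtchouk (Suc m) (Suc k) (x + 1) =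
      ?b (Suc k) + (\<Sum>i = 0..k. (- 1) ^ Suc i * ((x + 1) gchoose Suc i) * ?b (k - i))"
    unfolding krawtchouk_def by (subst sum.atLeast0_atMost_Suc_shift) simp
  also have "\<dots> = (?b (Suc k) + (\<Sum>i = 0..k. (- 1) ^ Suc i * (x gchoose Suc i) * ?b (k - i)))
      - (\<Sum>i = 0..k. (- 1) ^ i * (x gchoose i) * ?b (k - i))"
    unfolding gbinomial_Suc_shift
    by (simp add: algebra_simps sum.distrib sum_subtractf sum_negf)
  also have "?b (Suc k) + (\<Sum>i = 0..k. (- 1) ^ Suc i * (x gchoose Suc i) * ?b (k - i)) =
      krawtchouk m (Suc k) x"
    unfolding krawtchouk_def by (subst sum.atLeast0_atMost_Suc_shift) simp
  finally show ?thesis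
    by (simp add: krawtchouk_def)
qed

text \<open>The companion recurrence: raising \<open>m\<close> alone adds a factor
  \<open>1 + s\<close>.\<close>

lemma krawtchouk_Suc_Suc:
  "krawtchouk (Suc m) (Suc k) x = krawtchouk m (Suc k) x + krawtchouk m k x"
proof -
  have *: "(real (Suc m) - x) gchoose (Suc k - i) =
      ((real m - x) gchoose (Suc k - i)) + ((real m - x) gchoose (k - i))" if "i \<le> k" for i
    using gbinomial_Suc_shift[of "real m - x" "k - i"] that by (simp add: Suc_diff_le algebra_simps)
  \<comment> \<open>The top summand is split off because its last factor is
    \<open>_ gchoose 0 = 1\<close>, to which Pascal's rule does not apply.\<close>
  have "krawtchouk (Suc m) (Suc k) x =
      (\<Sum>i = 0..k. (- 1) ^ i * (x gchoose i) * ((real (Suc m) - x) gchoose (Suc k - i)))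
        + (- 1) ^ Suc k * (x gchoose Suc k)"
    unfolding krawtchouk_def by simp
  also have "(\<Sum>i = 0..k. (- 1) ^ i * (x gchoose i) * ((real (Suc m) - x) gchoose (Suc k - i))) =
      (\<Sum>i = 0..k. (- 1) ^ i * (x gchoose i) * ((real m - x) gchoose (Suc k - i)))
        + krawtchouk m k x"
    unfolding krawtchouk_def sum.distrib[symmetric]
    by (rule sum.cong) (simp_all add: * algebra_simps del: of_nat_Suc)
  finally show ?thesis
    by (simp add: krawtchouk_def)
qed

lemma krawtchouk_0_0: "krawtchouk 0 k 0 = of_bool (k = 0)"
proof -
  have "krawtchouk 0 k 0 = (\<Sum>i = 0..k. if i = 0 then of_bool (k = 0) else 0)"
    unfolding krawtchouk_def by (rule sum.cong) (auto simp: gbinomial_0_left)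
  then show ?thesis by simp
qed

text \<open>The shift recurrence telescopes. This is the source of \<open>n - 1\<close> and
  \<open>k - 1\<close> in the theorem.\<close>

lemma sum_krawtchouk:
  "(\<Sum>j\<le>t. krawtchouk (Suc m) j x) = krawtchouk m t (x - 1)"
  using krawtchouk_Suc_Suc_shift[of m _ "x - 1"] by (induction t) simp_all

section \<open>Characters of the cube\<close>

text \<open>This is (-1) to the power of the inner product of \<open>u\<close> and \<open>z\<close>,
  peeled off bit by bit to match \<open>sum_cube_Suc\<close>. For words of equal length the second
  equation is reached only at the empty words.\<close>

fun character :: "bool list \<Rightarrow> bool list \<Rightarrow> real" where
  "character (a # u) (b # z) = (if a \<and> b then - 1 else 1) * character u z"
| "character _ _ = 1"

lemma character_commute: "character u z = character z u"
  by (induction u z rule: character.induct) auto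

abbreviation weight :: "bool list \<Rightarrow> nat" where
  "weight u \<equiv> count_list u True"

lemma hamming_zero: "hamming (replicate (length u) False) u = weight u"
  by (induction u) simp_all

lemma weight_le: "u \<in> cube n \<Longrightarrow> weight u \<le> n"
  using count_le_length[of u True] by (simp add: cube_def)

lemma hamming_commute: "length x = length y \<Longrightarrow> hamming x y = hamming y x"
  unfolding hamming_def by metis

lemma cube_SucE:
  assumes "x \<in> cube (Suc n)"
  obtains a x' where "x = a # x'" "x' \<in> cube n"
  using assms by (auto simp: cube_def length_Suc_conv)

text \<open>Marking weight by \<open>s\<close>, the sum over \<open>u\<close> factors over
  coordinates: \<open>1 + s\<close> where \<open>y\<close> and \<open>z\<close> agree,
  \<open>1 - s\<close> where they differ. The induction removes one coordinate and uses the matching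
  Krawtchouk recurrence.\<close>

lemma sum_character_weight:
  assumes "y \<in> cube n" "z \<in> cube n"
  shows "(\<Sum>u \<in> cube n. of_bool (weight u = k) * (character u y * character u z)) =
    krawtchouk n k (real (hamming y z))"
  using assms
proof (induction n arbitrary: k y z)
  case 0
  then show ?case by (simp add: cube_0 krawtchouk_0_0)
next
  case (Suc n)
  obtain a y' where y: "y = a # y'" "y' \<in> cube n" using Suc.prems(1) by (rule cube_SucE)
  obtain b z' where z: "z = b # z'" "z' \<in> cube n" using Suc.prems(2) by (rule cube_SucE)
  define S where "S j = (\<Sum>u \<in> cube n. of_bool (weight u = j) * (character u y' * character u z'))"
    for j
  \<comment> \<open>The sign contributed by a leading \<open>True\<close> in \<open>u\<close>; a
    leading \<open>False\<close> contributes 1.\<close>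
  define s :: real where "s = (if a = b then 1 else - 1)"
  have S: "S j = krawtchouk n j (real (hamming y' z'))" for j
    unfolding S_def using Suc.IH y z by blast
  have "(\<Sum>u \<in> cube (Suc n). of_bool (weight u = k) * (character u y * character u z)) =
      s * (\<Sum>u \<in> cube n. of_bool (Suc (weight u) = k) * (character u y' * character u z')) + S k"
    unfolding sum_cube_Suc S_def sum_distrib_left sum.distrib[symmetric]
    by (rule sum.cong) (auto simp: y z s_def)
  also have "\<dots> = krawtchouk (Suc n) k (real (hamming y z))"
  proof (cases k)
    case 0
    then show ?thesis by (simp add: S)
  next
    case (Suc j)
    then have "(\<Sum>u \<in> cube n. of_bool (Suc (weight u) = k) * (character u y' * character u z')) = S j"
      by (simp add: S_def)
    then show ?thesis
      using krawtchouk_Suc_Suc_shift[of n j "real (hamming y' z')"]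
      by (simp add: Suc S s_def y z krawtchouk_Suc_Suc add.commute)
  qed
  finally show ?case .
qed

section \<open>Fourier transform on the cube\<close>

lemma character_weight_0: "weight u = 0 \<Longrightarrow> character u z = 1"
  by (induction u z rule: character.induct) (auto split: if_splits)

lemma sum_character:
  assumes "u \<in> cube n"
  shows "(\<Sum>z \<in> cube n. character u z) = (if weight u = 0 then 2 ^ n else 0)"
  using assms
proof (induction n arbitrary: u)
  case 0
  then show ?case by (simp add: cube_0)
next
  case (Suc n)
  obtain a u' where u: "u = a # u'" "u' \<in> cube n" using Suc.prems by (rule cube_SucE)
  then show ?case
    using Suc.IH[of u'] by (cases a) (auto simp: sum_cube_Suc simp flip: sum_distrib_left)
qed

text \<open>Translating \<open>x\<close> by \<open>z\<close> turns distance to \<open>z\<close> into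
  weight and pulls out \<open>character u z\<close>. The induction does this one bit at a time, with
  \<open>F\<close> generalised.\<close>

lemma sum_radial_character:
  fixes F :: "nat \<Rightarrow> real"
  assumes "z \<in> cube n" "u \<in> cube n"
  shows "(\<Sum>x \<in> cube n. F (hamming x z) * character u x) =
    character u z * (\<Sum>x \<in> cube n. F (weight x) * character u x)"
  using assms
proof (induction n arbitrary: F z u)
  case 0
  then show ?case by (simp add: cube_0)
next
  case (Suc n)
  obtain a u' where u: "u = a # u'" "u' \<in> cube n" using Suc.prems(2) by (rule cube_SucE)
  obtain b z' where z: "z = b # z'" "z' \<in> cube n" using Suc.prems(1) by (rule cube_SucE)
  define s :: real where "s = (if a then - 1 else 1)"
  define c :: real where "c = (if a \<and> b then - 1 else 1)"
  \<comment> \<open>The first bit of \<open>x\<close> is summed out: the value differing from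
    \<open>b\<close> gives \<open>F (Suc d)\<close>, the equal one \<open>F d\<close>. Their
    relative sign is \<open>s\<close>, and \<open>c\<close> is
    \<open>character [a] [b]\<close>.\<close>
  define G where "G d = s * F (Suc d) + F d" for d
  have "(\<Sum>x \<in> cube (Suc n). F (hamming x z) * character u x) =
      c * (\<Sum>x \<in> cube n. G (hamming x z') * character u' x)"
    unfolding sum_cube_Suc sum_distrib_left
    by (rule sum.cong) (auto simp: u z s_def c_def G_def algebra_simps)
  also have "\<dots> = c * character u' z' * (\<Sum>x \<in> cube n. G (weight x) * character u' x)"
    using Suc.IH[OF z(2) u(2), of G] by simp
  also have "(\<Sum>x \<in> cube n. G (weight x) * character u' x) =
      (\<Sum>x \<in> cube (Suc n). F (weight x) * character u x)"
    unfolding sum_cube_Suc by (rule sum.cong) (auto simp: u s_def G_def algebra_simps)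
  finally show ?case by (simp add: u z c_def)
qed

text \<open>A leading \<open>True\<close> or \<open>False\<close> in \<open>u\<close> produces the
  difference or the sum of the two halves of \<open>h\<close>; the parallelogram law then yields a
  factor 2 per coordinate.\<close>

lemma parseval_cube:
  "(\<Sum>u \<in> cube n. (\<Sum>x \<in> cube n. h x * character u x)\<^sup>2) = 2 ^ n * (\<Sum>x \<in> cube n. (h x)\<^sup>2)"
proof (induction n arbitrary: h)
  case 0
  then show ?case by (simp add: cube_0)
next
  case (Suc n)
  let ?d = "\<lambda>x. h (False # x) - h (True # x)" and ?s = "\<lambda>x. h (False # x) + h (True # x)"
  have "(\<Sum>u \<in> cube (Suc n). (\<Sum>x \<in> cube (Suc n). h x * character u x)\<^sup>2) =
      (\<Sum>u \<in> cube n. (\<Sum>x \<in> cube n. ?d x * character u x)\<^sup>2) +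
      (\<Sum>u \<in> cube n. (\<Sum>x \<in> cube n. ?s x * character u x)\<^sup>2)"
    unfolding sum_cube_Suc by (simp add: sum.distrib algebra_simps)
  also have "\<dots> = 2 ^ n * (\<Sum>x \<in> cube n. (?d x)\<^sup>2 + (?s x)\<^sup>2)"
    by (simp add: Suc.IH sum.distrib distrib_left)
  also have "\<dots> = 2 ^ Suc n * (\<Sum>x \<in> cube (Suc n). (h x)\<^sup>2)"
    unfolding sum_cube_Suc sum_distrib_left
    by (rule sum.cong) (auto simp: power2_eq_square algebra_simps)
  finally show ?case .
qed

text \<open>The ball is a disjoint union of spheres, and the transform of a sphere is
  \<open>sum_character_weight\<close> with one word zero, where the character is trivial.\<close>

lemma ball_transform:
  assumes "u \<in> cube n"
  shows "(\<Sum>x \<in> cube n. of_bool (weight x \<le> t) * character u x) =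
    (\<Sum>j\<le>t. krawtchouk n j (real (weight u)))"
proof -
  have len: "length u = n" using assms by (simp add: cube_def)
  have *: "krawtchouk n j (real (weight u)) =
      (\<Sum>x \<in> cube n. of_bool (weight x = j) * character u x)" for j
    using sum_character_weight[of "replicate n False" n u j] assms hamming_zero[of u] len
    by (simp add: cube_def character_weight_0 count_list_0_iff character_commute[of u]
        character_commute[of _ "replicate n False"])
  have "(\<Sum>j\<le>t. of_bool (weight x = j)) = (of_bool (weight x \<le> t) :: real)" for x
    by (simp add: of_bool_def)
  then show ?thesis
    unfolding * by (subst sum.swap) (simp flip: sum_distrib_right)
qed

section \<open>The signed measure of a code\<close>

definition code_measure :: "nat \<Rightarrow> bool list set \<Rightarrow> bool list \<Rightarrow> real" where
  "code_measure n Z z = indicator Z z / real (card Z) - 1 / 2 ^ n"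

lemma card_cube: "card (cube n) = 2 ^ n"
  using card_lists_length_eq[of "UNIV :: bool set" n] by (simp add: cube_def)

lemma sum_code_measure:
  assumes "Z \<subseteq> cube n"
  shows "(\<Sum>z \<in> cube n. code_measure n Z z * f z) =
    (\<Sum>z \<in> Z. f z) / real (card Z) - (\<Sum>z \<in> cube n. f z) / 2 ^ n"
proof -
  have "(\<Sum>z \<in> cube n. indicator Z z * f z) = (\<Sum>z \<in> Z. f z)"
    using assms by (intro sum.mono_neutral_cong_right) (auto simp: indicator_def)
  then show ?thesis
    by (simp add: code_measure_def left_diff_distrib sum_subtractf sum_divide_distrib[symmetric])
qed

lemma discrepancy_eq_sum_convolution:
  assumes "Z \<subseteq> cube n"
  shows "discrepancy n g Z = (\<Sum>t\<le>n. g t * (\<Sum>x \<in> cube n.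
    (\<Sum>z \<in> cube n. code_measure n Z z * of_bool (hamming x z \<le> t))\<^sup>2))"
proof -
  have 1: "(\<Sum>z \<in> Z. indicator (hball n x t) z) = (\<Sum>z \<in> Z. of_bool (hamming x z \<le> t) :: real)" for x t
    using assms by (intro sum.cong) (auto simp: hball_def indicator_def)
  have 2: "real (card (hball n x t)) = (\<Sum>z \<in> cube n. of_bool (hamming x z \<le> t))" for x t
    by (simp add: hball_def of_bool_def sum.If_cases Int_def)
  show ?thesis
    unfolding discrepancy_def sum_code_measure[OF assms] 1 2 by (simp add: atLeast0AtMost)
qed

section \<open>Stolarsky's identity\<close>

text \<open>Either side adds up \<open>g t\<close> over those \<open>t \<le> n\<close> that lie
  between the two distances, the smaller included and the larger excluded: exactly there the two
  indicators differ.\<close>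

lemma abs_tail_weight_diff:
  assumes "\<And>t. t \<le> n \<Longrightarrow> g t \<ge> 0"
  shows "\<bar>tail_weight n g d - tail_weight n g e\<bar> =
    (\<Sum>t\<le>n. g t * (of_bool (d \<le> t) - of_bool (e \<le> t))\<^sup>2)"
proof -
  have tail: "tail_weight n g d = (\<Sum>t\<le>n. g t * of_bool (d \<le> t))" for d
    unfolding tail_weight_def by (rule sum.mono_neutral_cong_left) auto
  have *: "\<bar>tail_weight n g d - tail_weight n g e\<bar> =
      (\<Sum>t\<le>n. g t * (of_bool (d \<le> t) - of_bool (e \<le> t))\<^sup>2)" if "d \<le> e" for d e
  proof -
    have "tail_weight n g d - tail_weight n g e =
        (\<Sum>t\<le>n. g t * (of_bool (d \<le> t) - of_bool (e \<le> t))\<^sup>2)"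
      unfolding tail sum_subtractf[symmetric] using that by (intro sum.cong) auto
    moreover have "\<dots> \<ge> 0" using assms by (intro sum_nonneg) auto
    ultimately show ?thesis by simp
  qed
  show ?thesis
    using *[of d e] *[of e d] by (cases "d \<le> e") (simp_all add: abs_minus_commute power2_commute)
qed

lemma pair_potential_eq:
  assumes "\<And>t. t \<le> n \<Longrightarrow> g t \<ge> 0" and "y \<in> cube n" "z \<in> cube n"
  shows "pair_potential n g y z = 1 / 2 * (\<Sum>t\<le>n. g t *
    (\<Sum>x \<in> cube n. (of_bool (hamming x y \<le> t) - of_bool (hamming x z \<le> t))\<^sup>2))"
proof -
  have "pair_potential n g y z = 1 / 2 * (\<Sum>x \<in> cube n. \<Sum>t\<le>n. g t *
    (of_bool (hamming x y \<le> t) - of_bool (hamming x z \<le> t))\<^sup>2)"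
    unfolding pair_potential_def
  proof (intro arg_cong2[where f = "(*)"] sum.cong refl)
    fix x assume "x \<in> cube n"
    then have "hamming y x = hamming x y" "hamming z x = hamming x z"
      using assms(2,3) by (auto simp: cube_def intro: hamming_commute)
    then show "\<bar>tail_weight n g (hamming y x) - tail_weight n g (hamming z x)\<bar> =
        (\<Sum>t\<le>n. g t * (of_bool (hamming x y \<le> t) - of_bool (hamming x z \<le> t))\<^sup>2)"
      by (simp only: abs_tail_weight_diff[OF assms(1)])
  qed
  then show ?thesis by (subst (asm) sum.swap) (simp add: sum_distrib_left)
qed

text \<open>On expanding \<open>(f y - f z)\<^sup>2\<close>, both pure squares leave one variable
  free and vanish by mass zero; only the cross term survives.\<close>

lemma square_sum_mass_zero:
  fixes \<nu> f :: "'a \<Rightarrow> real"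
  assumes "(\<Sum>z \<in> A. \<nu> z) = 0"
  shows "(\<Sum>z \<in> A. \<nu> z * f z)\<^sup>2 = - (\<Sum>y \<in> A. \<Sum>z \<in> A. \<nu> y * \<nu> z * (1 / 2 * (f y - f z)\<^sup>2))"
proof -
  have "(\<Sum>y \<in> A. \<Sum>z \<in> A. \<nu> y * \<nu> z * (1 / 2 * (f y - f z)\<^sup>2)) =
      (\<Sum>y \<in> A. \<Sum>z \<in> A. (\<nu> y * (f y)\<^sup>2 / 2) * \<nu> z + \<nu> y * (\<nu> z * (f z)\<^sup>2 / 2)
        - (\<nu> y * f y) * (\<nu> z * f z))"
    by (intro sum.cong) (auto simp: power2_eq_square field_simps)
  also have "\<dots> = - ((\<Sum>z \<in> A. \<nu> z * f z) * (\<Sum>z \<in> A. \<nu> z * f z))"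
    unfolding sum_subtractf sum.distrib sum_product[symmetric] by (simp add: assms)
  finally show ?thesis by (simp add: power2_eq_square)
qed

text \<open>The pairs \<open>(y, y)\<close> and \<open>(z, z)\<close> have the same distance 0, so
  \<open>sum_cube_hamming_cong\<close> applies with an \<open>F\<close> that ignores its second
  argument.\<close>

lemma sum_pair_potential_cong:
  assumes "y \<in> cube n" "z \<in> cube n"
  shows "(\<Sum>x \<in> cube n. pair_potential n g y x) = (\<Sum>x \<in> cube n. pair_potential n g z x)"
proof -
  have "hamming y y = hamming z z" by (simp add: hamming_def)
  from sum_cube_hamming_cong[OF assms(1,1,2,2) this, of "\<lambda>i j. potential n g i"]
  show ?thesis using assms by (simp add: potential_hamming)
qed

lemma pair_potential_commute: "pair_potential n g y z = pair_potential n g z y"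
  unfolding pair_potential_def by (simp add: abs_minus_commute)

lemma stolarsky:
  assumes Z: "Z \<subseteq> cube n" "Z \<noteq> {}" and g: "\<And>t. t \<le> n \<Longrightarrow> g t \<ge> 0"
  shows "discrepancy n g Z = (\<Sum>y \<in> cube n. \<Sum>z \<in> cube n. pair_potential n g y z) / 2 ^ (2 * n)
    - (\<Sum>y \<in> Z. \<Sum>z \<in> Z. pair_potential n g y z) / (real (card Z))\<^sup>2"
proof -
  let ?\<nu> = "code_measure n Z" and ?p = "pair_potential n g"
  let ?f = "\<lambda>t x z. of_bool (hamming x z \<le> t) :: real"
  have fin: "finite Z" using Z(1) finite_cube finite_subset by blast
  then have pos: "real (card Z) > 0" using Z(2) by (simp add: card_gt_0_iff)
  have mass: "(\<Sum>z \<in> cube n. ?\<nu> z) = 0"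
    using sum_code_measure[OF Z(1), of "\<lambda>_. 1"] pos by (simp add: card_cube)
  have "discrepancy n g Z = - (\<Sum>t\<le>n. \<Sum>x \<in> cube n. \<Sum>y \<in> cube n. \<Sum>z \<in> cube n.
      g t * (?\<nu> y * ?\<nu> z * (1 / 2 * (?f t x y - ?f t x z)\<^sup>2)))"
    unfolding discrepancy_eq_sum_convolution[OF Z(1)] square_sum_mass_zero[OF mass]
    by (simp only: sum_distrib_left sum_negf mult_minus_right)
  also have "(\<Sum>t\<le>n. \<Sum>x \<in> cube n. \<Sum>y \<in> cube n. \<Sum>z \<in> cube n.
      g t * (?\<nu> y * ?\<nu> z * (1 / 2 * (?f t x y - ?f t x z)\<^sup>2))) =
      (\<Sum>y \<in> cube n. \<Sum>t\<le>n. \<Sum>x \<in> cube n. \<Sum>z \<in> cube n.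
      g t * (?\<nu> y * ?\<nu> z * (1 / 2 * (?f t x y - ?f t x z)\<^sup>2)))"
    \<comment> \<open>First \<open>y\<close>, then \<open>z\<close> is moved outermost, so that the
      sums over \<open>t\<close> and \<open>x\<close> assemble into
      \<open>pair_potential\<close>.\<close>
    by (subst (2) sum.swap, subst sum.swap) (rule refl)
  also have "\<dots> = (\<Sum>y \<in> cube n. \<Sum>z \<in> cube n. \<Sum>t\<le>n. \<Sum>x \<in> cube n.
      g t * (?\<nu> y * ?\<nu> z * (1 / 2 * (?f t x y - ?f t x z)\<^sup>2)))"
    by (subst (3) sum.swap, subst (2) sum.swap) (rule refl)
  also have "\<dots> = (\<Sum>y \<in> cube n. \<Sum>z \<in> cube n. ?\<nu> y * ?\<nu> z * ?p y z)"
    by (intro sum.cong refl) (simp add: pair_potential_eq[OF g] sum_distrib_left mult_ac)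
  also have "\<dots> = (\<Sum>y \<in> cube n. ?\<nu> y * (\<Sum>z \<in> cube n. ?\<nu> z * ?p y z))"
    by (simp add: sum_distrib_left mult.assoc)
  finally have D: "discrepancy n g Z = - (\<Sum>y \<in> cube n. ?\<nu> y * (\<Sum>z \<in> cube n. ?\<nu> z * ?p y z))" .
  obtain z0 where z0: "z0 \<in> cube n" using Z by blast
  \<comment> \<open>With \<open>L\<close> the common row sum, each of the two mixed terms has size
    \<open>L / 2 ^ n\<close>, as does the mean over the cube; one of the three cancels another,
    leaving the mean with a plus sign.\<close>
  define L where "L = (\<Sum>x \<in> cube n. ?p z0 x)"
  have L: "(\<Sum>x \<in> cube n. ?p y x) = L" if "y \<in> cube n" for y
    unfolding L_def using that z0 by (rule sum_pair_potential_cong)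
  have ZL: "(\<Sum>y \<in> Z. \<Sum>x \<in> cube n. ?p y x) = card Z * L"
    using L Z(1) by (simp add: subset_iff)
  have CL: "(\<Sum>y \<in> cube n. \<Sum>x \<in> cube n. ?p y x) = 2 ^ n * L"
    by (simp add: L card_cube)
  have ZL': "(\<Sum>x \<in> cube n. \<Sum>y \<in> Z. ?p x y) = card Z * L"
    by (subst sum.swap, subst pair_potential_commute) (rule ZL)
  show ?thesis
    unfolding D sum_code_measure[OF Z(1)] sum_subtractf sum_divide_distrib[symmetric] ZL CL ZL'
    using pos by (simp add: field_simps power2_eq_square power_mult power_mult_distrib mult_2 power_add)
qed

section \<open>Sums over pairs of codewords, grouped by distance\<close>

lemma sum_dist_distr:
  assumes Z: "Z \<subseteq> cube n"
  shows "(\<Sum>w = 0..n. dist_distr Z w * F w) = (\<Sum>y \<in> Z. \<Sum>z \<in> Z. F (hamming y z)) / real (card Z)"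
proof -
  have fin: "finite Z" using Z finite_cube finite_subset by blast
  have "(\<Sum>y \<in> Z. \<Sum>z \<in> Z. F (hamming y z)) = (\<Sum>p \<in> Z \<times> Z. F (hamming (fst p) (snd p)))"
    by (simp add: sum.cartesian_product case_prod_beta)
  also have "\<dots> = (\<Sum>w = 0..n. \<Sum>p \<in> {p \<in> Z \<times> Z. hamming (fst p) (snd p) = w}.
      F (hamming (fst p) (snd p)))"
    using fin Z hamming_le_length
    by (intro sum.group[symmetric]) (fastforce simp: cube_def)+
  also have "\<dots> = (\<Sum>w = 0..n. real (card {(z, z'). z \<in> Z \<and> z' \<in> Z \<and> hamming z z' = w}) * F w)"
  proof (rule sum.cong)
    fix w
    have "{p \<in> Z \<times> Z. hamming (fst p) (snd p) = w} =
        {(z, z'). z \<in> Z \<and> z' \<in> Z \<and> hamming z z' = w}" by auto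
    then show "(\<Sum>p \<in> {p \<in> Z \<times> Z. hamming (fst p) (snd p) = w}. F (hamming (fst p) (snd p))) =
      real (card {(z, z'). z \<in> Z \<and> z' \<in> Z \<and> hamming z z' = w}) * F w"
      by (subst sum.cong[OF refl, where h="\<lambda>_. F w"]) auto
  qed simp
  finally show ?thesis
    by (simp add: dist_distr_def sum_divide_distrib)
qed

text \<open>Diagonal pairs contribute nothing, so sums over distances may start at 0 or at
  1.\<close>

lemma potential_0: "potential n g 0 = 0"
proof -
  let ?x = "replicate n False"
  have "?x \<in> cube n" "hamming ?x ?x = 0" by (simp_all add: cube_def hamming_def)
  then show ?thesis
    using potential_hamming[of ?x n ?x g] by (simp add: pair_potential_def)
qed

section \<open>The spectral formula\<close>

text \<open>Writing \<open>krawtchouk n k\<close> as a character sum separates \<open>y\<close> from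
  \<open>z\<close>, and the double sum over the code becomes a square.\<close>

lemma dual_distr_eq_sum_character:
  assumes Z: "Z \<subseteq> cube n"
  shows "dual_distr n Z k =
    (\<Sum>u \<in> cube n. of_bool (weight u = k) * ((\<Sum>z \<in> Z. character u z) / real (card Z))\<^sup>2)"
proof -
  have "dual_distr n Z k = (\<Sum>y \<in> Z. \<Sum>z \<in> Z. krawtchouk n k (real (hamming y z))) / (real (card Z))\<^sup>2"
    unfolding dual_distr_def
    using sum_dist_distr[OF Z, of "\<lambda>i. krawtchouk n k (real i)"]
    by (simp add: mult.commute power2_eq_square)
  also have "(\<Sum>y \<in> Z. \<Sum>z \<in> Z. krawtchouk n k (real (hamming y z))) =
      (\<Sum>y \<in> Z. \<Sum>z \<in> Z. \<Sum>u \<in> cube n. of_bool (weight u = k) * (character u y * character u z))"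
    using Z by (intro sum.cong refl sum_character_weight[symmetric]) auto
  also have "\<dots> = (\<Sum>u \<in> cube n. \<Sum>y \<in> Z. \<Sum>z \<in> Z.
      of_bool (weight u = k) * (character u y * character u z))"
    by (subst (2) sum.swap, subst sum.swap) (rule refl)
  also have "\<dots> = (\<Sum>u \<in> cube n. of_bool (weight u = k) * (\<Sum>z \<in> Z. character u z)\<^sup>2)"
    unfolding power2_eq_square sum_product by (simp only: sum_distrib_left)
  finally show ?thesis
    by (simp add: power_divide flip: sum_divide_distrib)
qed

text \<open>The convolution theorem for a radial kernel: swap the sums and apply
  \<open>sum_radial_character\<close> to each translate.\<close>

lemma convolution_transform:
  fixes F :: "nat \<Rightarrow> real"
  assumes "u \<in> cube n"
  shows "(\<Sum>x \<in> cube n. (\<Sum>z \<in> cube n. \<nu> z * F (hamming x z)) * character u x) =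
    (\<Sum>z \<in> cube n. \<nu> z * character u z) * (\<Sum>x \<in> cube n. F (weight x) * character u x)"
proof -
  have "(\<Sum>x \<in> cube n. (\<Sum>z \<in> cube n. \<nu> z * F (hamming x z)) * character u x) =
      (\<Sum>z \<in> cube n. \<nu> z * (\<Sum>x \<in> cube n. F (hamming x z) * character u x))"
    unfolding sum_distrib_left sum_distrib_right by (subst sum.swap) (simp add: mult.assoc)
  also have "\<dots> = (\<Sum>z \<in> cube n. \<nu> z * (character u z * (\<Sum>x \<in> cube n. F (weight x) * character u x)))"
    using assms by (intro sum.cong refl) (simp add: sum_radial_character)
  finally show ?thesis
    by (simp add: sum_distrib_right mult.assoc)
qed

lemma discrepancy_spectral:
  assumes Z: "Z \<subseteq> cube n" "Z \<noteq> {}"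
  shows "discrepancy n g Z = 1 / 2 ^ n * (\<Sum>k = 1..n. dual_distr n Z k *
    (\<Sum>t<n. g t * (krawtchouk (n - 1) t (real k - 1))\<^sup>2))"
proof -
  let ?\<nu> = "code_measure n Z"
  have fin: "finite Z" using Z(1) finite_cube finite_subset by blast
  then have pos: "real (card Z) > 0" using Z(2) by (simp add: card_gt_0_iff)
  define c where "c u = (\<Sum>z \<in> Z. character u z) / real (card Z)" for u
  define K where "K k t = (\<Sum>j\<le>t. krawtchouk n j (real k))" for k t
  define M where "M k = (\<Sum>t<n. g t * (krawtchouk (n - 1) t (real k - 1))\<^sup>2)" for k :: nat
  \<comment> \<open>The uniform measure has only a trivial Fourier coefficient, and there it cancels
    that of the code. Hence the final sum starts at \<open>k = 1\<close>.\<close>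
  have \<nu>: "(\<Sum>z \<in> cube n. ?\<nu> z * character u z) = of_bool (weight u \<noteq> 0) * c u" if "u \<in> cube n" for u
    using that pos by (auto simp: character_weight_0 sum_code_measure[OF Z(1)] sum_character c_def)
  have "(\<Sum>x \<in> cube n. (\<Sum>z \<in> cube n. ?\<nu> z * of_bool (hamming x z \<le> t))\<^sup>2) =
      1 / 2 ^ n * (\<Sum>u \<in> cube n. of_bool (weight u \<noteq> 0) * (c u)\<^sup>2 * (K (weight u) t)\<^sup>2)" for t
  proof -
    have "2 ^ n * (\<Sum>x \<in> cube n. (\<Sum>z \<in> cube n. ?\<nu> z * of_bool (hamming x z \<le> t))\<^sup>2) =
      (\<Sum>u \<in> cube n. of_bool (weight u \<noteq> 0) * (c u)\<^sup>2 * (K (weight u) t)\<^sup>2)"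
      unfolding parseval_cube[symmetric]
      by (intro sum.cong refl, subst convolution_transform[where F = "\<lambda>d. of_bool (d \<le> t)"], assumption)
        (simp only: ball_transform \<nu> K_def power_mult_distrib, simp)
    then show ?thesis by (simp add: field_simps)
  qed
  then have "discrepancy n g Z = 1 / 2 ^ n * (\<Sum>t\<le>n. \<Sum>u \<in> cube n.
      g t * (of_bool (weight u \<noteq> 0) * (c u)\<^sup>2 * (K (weight u) t)\<^sup>2))"
    by (simp add: discrepancy_eq_sum_convolution[OF Z(1)] sum_distrib_left mult_ac)
  also have "(\<Sum>t\<le>n. \<Sum>u \<in> cube n. g t * (of_bool (weight u \<noteq> 0) * (c u)\<^sup>2 * (K (weight u) t)\<^sup>2)) =
      (\<Sum>u \<in> cube n. of_bool (weight u \<noteq> 0) * (c u)\<^sup>2 * (\<Sum>t\<le>n. g t * (K (weight u) t)\<^sup>2))"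
    by (subst sum.swap) (simp add: sum_distrib_left mult_ac)
  also have "\<dots> = (\<Sum>u \<in> cube n. \<Sum>k = 1..n. of_bool (weight u = k) * (c u)\<^sup>2 * M k)"
  proof (rule sum.cong)
    fix u assume u: "u \<in> cube n"
    show "of_bool (weight u \<noteq> 0) * (c u)\<^sup>2 * (\<Sum>t\<le>n. g t * (K (weight u) t)\<^sup>2) =
        (\<Sum>k = 1..n. of_bool (weight u = k) * (c u)\<^sup>2 * M k)"
    proof (cases "weight u = 0")
      case True
      then show ?thesis by simp
    next
      case False
      with weight_le[OF u] obtain m where n: "n = Suc m" by (cases n) auto
      \<comment> \<open>The ball of radius \<open>n\<close> is the whole cube, whose transform
        vanishes off the trivial character. So the term \<open>t = n\<close> drops out, leaving
        \<open>t < n\<close>.\<close>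
      have "K (weight u) n = (\<Sum>x \<in> cube n. character u x)"
        unfolding K_def ball_transform[OF u, symmetric]
        using weight_le by (intro sum.cong refl) auto
      then have "K (weight u) n = 0" using False by (simp add: sum_character[OF u])
      moreover have "{..n} = insert n {..<n}" by auto
      ultimately have "(\<Sum>t\<le>n. g t * (K (weight u) t)\<^sup>2) = M (weight u)"
        by (simp add: M_def K_def n sum_krawtchouk)
      moreover have "(\<Sum>k = 1..n. of_bool (weight u = k) * (c u)\<^sup>2 * M k) =
          (\<Sum>k = 1..n. if weight u = k then (c u)\<^sup>2 * M k else 0)"
        by (rule sum.cong) auto
      ultimately show ?thesis using False weight_le[OF u] by simp
    qed
  qed simp
  also have "\<dots> = (\<Sum>k = 1..n. dual_distr n Z k * M k)"
    unfolding dual_distr_eq_sum_character[OF Z(1)] c_def sum_distrib_right by (rule sum.swap)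
  finally show ?thesis by (simp add: M_def)
qed

theorem theorem6p3:
  fixes n N :: nat and Z :: "bool list set" and g :: "nat \<Rightarrow> real"
  assumes "Z \<subseteq> cube n" and "Z \<noteq> {}" and "card Z = N"
    and "\<And>t. t \<le> n \<Longrightarrow> g t \<ge> 0"
  shows "discrepancy n g Z =
           potential_mean n g - 1 / real N * (\<Sum>w = 1..n. dist_distr Z w * potential n g w)
       \<and> potential_mean n g - 1 / real N * (\<Sum>w = 1..n. dist_distr Z w * potential n g w) =
           1 / 2 ^ n * (\<Sum>k = 1..n. dual_distr n Z k *
             (\<Sum>t<n. g t * (krawtchouk (n - 1) t (real k - 1))\<^sup>2))"
proof -
  have "(\<Sum>w = 1..n. dist_distr Z w * potential n g w) =
      (\<Sum>w = 0..n. dist_distr Z w * potential n g w)"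
    by (rule sum.mono_neutral_left) (auto simp: potential_0 not_less_eq_eq)
  also have "\<dots> = (\<Sum>y \<in> Z. \<Sum>z \<in> Z. pair_potential n g y z) / real N"
    using assms(1,3) by (auto simp: sum_dist_distr subset_iff potential_hamming intro!: sum.cong)
  finally have "discrepancy n g Z =
      potential_mean n g - 1 / real N * (\<Sum>w = 1..n. dist_distr Z w * potential n g w)"
    using stolarsky[OF assms(1,2,4)] assms(3)
    by (simp add: potential_mean_def potential_hamming power2_eq_square)
  with discrepancy_spectral[OF assms(1,2)] show ?thesis by simp
qed

end
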